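(* Let $k \ge 1$ be an integer and let $G$ be a $k$-regular graph of order $n$. Then $\Psi_g^+(G) \ge \frac{1}{2}n$ and $\Psi_g^-(G) \ge \frac{1}{2}n$.
   Context: All graphs are finite and simple. For a set $S$ of vertices of a graph $G$, a vertex $v \in S$ is an enclave of $S$ if $v$ and all its neighbors lie in $S$ (i.e. $N[v] \subseteq S$); $S$ is enclaveless if it contains no enclave. The competition-enclaveless game on $G$ is played by two players, Maximizer and Minimizer, who alternately choose a vertex $v$ not in the set $S$ of previously chosen vertices such that $S \cup \{v\}$ is enclaveless; the game ends when no such vertex exists (so the final $S$ is a maximal enclaveless set). Maximizer aims to maximize and Minimizer to minimize the final $|S|$. $\Psi_g^+(G)$ is the final $|S|$ when Maximizer moves first and both play optimally; $\Psi_g^-(G)$ is the same quantity when Minimizer moves first. *)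

theory Defs
  imports Complex_Main "Graph_Theory.Graph_Theory"
begin

text \<open>Finite simple graphs are the library's \<^locale>\<open>pair_graph\<close>: finite, loop-free and symmetric,
  with each undirected edge represented by its two arcs.\<close>

definition nbhd :: "'a pair_pre_digraph \<Rightarrow> 'a \<Rightarrow> 'a set" where
  "nbhd G v = {u \<in> pverts G. (v, u) \<in> parcs G}"

definition closed_nbhd :: "'a pair_pre_digraph \<Rightarrow> 'a \<Rightarrow> 'a set" where
  "closed_nbhd G v = insert v (nbhd G v)"

definition regular_graph :: "nat \<Rightarrow> 'a pair_pre_digraph \<Rightarrow> bool" where
  "regular_graph k G \<longleftrightarrow> (\<forall>v \<in> pverts G. card (nbhd G v) = k)"

definition enclave :: "'a pair_pre_digraph \<Rightarrow> 'a set \<Rightarrow> 'a \<Rightarrow> bool" where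
  "enclave G S v \<longleftrightarrow> v \<in> S \<and> closed_nbhd G v \<subseteq> S"

definition enclaveless :: "'a pair_pre_digraph \<Rightarrow> 'a set \<Rightarrow> bool" where
  "enclaveless G S \<longleftrightarrow> (\<nexists>v. enclave G S v)"

definition legal_moves :: "'a pair_pre_digraph \<Rightarrow> 'a set \<Rightarrow> 'a set" where
  "legal_moves G S = {v \<in> pverts G - S. enclaveless G (insert v S)}"

datatype player = Maximizer | Minimizer

fun opponent :: "player \<Rightarrow> player" where
  "opponent Maximizer = Minimizer"
| "opponent Minimizer = Maximizer"

text \<open>The final \<open>card S\<close> under optimal play (backward induction) from the position in which \<open>S\<close> is
  the set of chosen vertices and player \<open>p\<close> is to move. The test for infinite vertex sets only
  serves to make the recursion total; it never applies to a \<^locale>\<open>pair_graph\<close>.\<close>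

function game_value :: "'a pair_pre_digraph \<Rightarrow> player \<Rightarrow> 'a set \<Rightarrow> nat" where
  "game_value G p S =
     (if infinite (pverts G) \<or> legal_moves G S = {} then card S
      else (case p of
          Maximizer \<Rightarrow> Max ((\<lambda>v. game_value G (opponent p) (insert v S)) ` legal_moves G S)
        | Minimizer \<Rightarrow> Min ((\<lambda>v. game_value G (opponent p) (insert v S)) ` legal_moves G S)))"
  by pat_completeness auto
termination
  by (relation "measure (\<lambda>(G, p, S). card (pverts G - S))")
    (auto simp: legal_moves_def card_gt_0_iff intro!: diff_less)

declare game_value.simps [simp del]

definition Psi_g_plus :: "'a pair_pre_digraph \<Rightarrow> nat" where
  "Psi_g_plus G = game_value G Maximizer {}"

definition Psi_g_minus :: "'a pair_pre_digraph \<Rightarrow> nat" where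
  "Psi_g_minus G = game_value G Minimizer {}"

end

theory Submission
  imports Defs
begin

text \<open>The players' strategies play no role: every maximal enclaveless set \<open>S\<close> of a \<open>k\<close>-regular graph
  contains at least half of the vertices. Let \<open>D\<close> be the complement of \<open>S\<close>. By maximality of \<open>S\<close>,
  each vertex of \<open>D\<close> either has all its neighbours in \<open>S\<close> (these form \<open>A\<close>) or has a private
  neighbour in \<open>S\<close>, whose only neighbour in \<open>D\<close> it is. The private neighbours chosen for \<open>D - A\<close> form
  a set \<open>C\<close> of the same size, and no vertex of \<open>C\<close> is adjacent to \<open>A\<close>. Hence the \<open>k |A|\<close> edges
  leaving \<open>A\<close> all end in \<open>S - C\<close>, which gives \<open>|A| \<le> |S - C|\<close> and so \<open>|D| \<le> |S|\<close>.\<close>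

lemma nbhd_sym:
  assumes "pair_graph G" "u \<in> nbhd G v" "v \<in> pverts G"
  shows "v \<in> nbhd G u"
proof -
  interpret pair_graph G by fact
  show ?thesis using assms(2,3) arcs_symmetric by (auto simp: nbhd_def)
qed

lemma nbhd_irrefl:
  assumes "pair_graph G"
  shows "v \<notin> nbhd G v"
proof -
  interpret pair_graph G by fact
  show ?thesis using no_loops by (fastforce simp: nbhd_def)
qed

text \<open>Adding \<open>v\<close> must create an enclave \<open>w\<close>. If
  \<open>w = v\<close>, all neighbours of \<open>v\<close> lie in \<open>S\<close>. Otherwise
  \<open>w\<close> was no enclave of \<open>S\<close> before, so \<open>v\<close> is its one
  neighbour outside \<open>S\<close>.\<close>

lemma maximal_enclaveless_cases:
  assumes G: "pair_graph G"
    and el: "enclaveless G S" and max: "legal_moves G S = {}"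
    and v: "v \<in> pverts G - S"
  obtains "nbhd G v \<subseteq> S" | w where "w \<in> S" "nbhd G w - S = {v}"
proof -
  have "\<not> enclaveless G (insert v S)"
    using max v by (auto simp: legal_moves_def)
  then obtain w where w: "w \<in> insert v S" "closed_nbhd G w \<subseteq> insert v S"
    by (auto simp: enclaveless_def enclave_def)
  show thesis
  proof (cases "w = v")
    case True
    then show ?thesis
      using w nbhd_irrefl[OF G, of v] that(1) by (auto simp: closed_nbhd_def)
  next
    case False
    with w have "w \<in> S" by simp
    moreover have "\<not> closed_nbhd G w \<subseteq> S"
      using el \<open>w \<in> S\<close> by (auto simp: enclaveless_def enclave_def)
    ultimately have "nbhd G w - S = {v}"
      using w by (auto simp: closed_nbhd_def)
    with \<open>w \<in> S\<close> show ?thesis by (rule that(2))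
  qed
qed

text \<open>Double counting of the adjacent pairs in \<open>A\<close> \<times> \<open>B\<close>:
  each vertex of \<open>A\<close> lies in exactly \<open>k\<close> of them, each vertex of
  \<open>B\<close> in at most \<open>k\<close>. Finally \<open>k\<close> \<ge> 1 allows cancelling
  \<open>k\<close>.\<close>

lemma card_regular_le:
  assumes G: "pair_graph G" and reg: "regular_graph k G" and k: "k \<ge> 1"
    and A: "A \<subseteq> pverts G" and B: "B \<subseteq> pverts G"
    and AB: "\<And>v. v \<in> A \<Longrightarrow> nbhd G v \<subseteq> B"
  shows "card A \<le> card B"
proof -
  interpret pair_graph G by fact
  have fin: "finite A" "finite B"
    using A B finite_subset[OF _ finite_verts] by auto
  have "k * card A = (\<Sum>v\<in>A. card {w \<in> B. w \<in> nbhd G v})"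
  proof -
    have "card {w \<in> B. w \<in> nbhd G v} = k" if "v \<in> A" for v
    proof -
      have "{w \<in> B. w \<in> nbhd G v} = nbhd G v" using AB[OF that] by auto
      then show ?thesis using reg that A by (auto simp: regular_graph_def)
    qed
    then show ?thesis by simp
  qed
  also have "\<dots> = (\<Sum>w\<in>B. card {v \<in> A. w \<in> nbhd G v})"
    using fin by (intro sum_multicount_gen) auto
  also have "\<dots> \<le> (\<Sum>w\<in>B. k)"
  proof (rule sum_mono)
    fix w assume w: "w \<in> B"
    have "{v \<in> A. w \<in> nbhd G v} \<subseteq> nbhd G w"
      using A nbhd_sym[OF G] by auto
    moreover have "finite (nbhd G w)" by (simp add: nbhd_def)
    ultimately have "card {v \<in> A. w \<in> nbhd G v} \<le> card (nbhd G w)"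
      by (rule card_mono[rotated])
    also have "\<dots> = k" using reg w B by (auto simp: regular_graph_def)
    finally show "card {v \<in> A. w \<in> nbhd G v} \<le> k" .
  qed
  also have "\<dots> = k * card B" by simp
  finally show ?thesis using k by simp
qed

lemma card_maximal_enclaveless:
  assumes G: "pair_graph G" and reg: "regular_graph k G" and k: "k \<ge> 1"
    and S: "S \<subseteq> pverts G" and el: "enclaveless G S" and max: "legal_moves G S = {}"
  shows "card (pverts G) \<le> 2 * card S"
proof -
  interpret pair_graph G by fact
  define D where "D = pverts G - S"
  define A where "A = {v \<in> D. nbhd G v \<subseteq> S}"
  have finS: "finite S" using S finite_verts by (rule finite_subset)
  have finD: "finite D" by (simp add: D_def)
  have "\<exists>w. w \<in> S \<and> nbhd G w - S = {v}" if "v \<in> D - A" for v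
    using maximal_enclaveless_cases[OF G el max, of v] that by (auto simp: A_def D_def)
  then obtain f where f: "\<And>v. v \<in> D - A \<Longrightarrow> f v \<in> S \<and> nbhd G (f v) - S = {v}"
    by metis
  define C where "C = f ` (D - A)"
  \<comment> \<open>The set \<open>nbhd G (f v) - S = {v}\<close> recovers \<open>v\<close> from
    \<open>f v\<close>.\<close>
  have "inj_on f (D - A)"
    by (rule inj_onI) (metis f singleton_inject)
  then have cardC: "card C = card (D - A)"
    by (simp add: C_def card_image)
  have CS: "C \<subseteq> S" using f by (auto simp: C_def)
  have "card A \<le> card (S - C)"
  proof (rule card_regular_le[OF G reg k])
    show "A \<subseteq> pverts G" "S - C \<subseteq> pverts G" using S by (auto simp: A_def D_def)
  next
    fix v assume v: "v \<in> A"
    show "nbhd G v \<subseteq> S - C"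
    proof
      fix w assume w: "w \<in> nbhd G v"
      have "v \<in> nbhd G w - S"
        using nbhd_sym[OF G w] v by (auto simp: A_def D_def)
      \<comment> \<open>If \<open>w = f u\<close> with \<open>u\<close> in \<open>D - A\<close>,
        then \<open>u\<close> is the only neighbour of \<open>w\<close> outside \<open>S\<close>, so
        \<open>u = v\<close>, although \<open>v\<close> is in \<open>A\<close>.\<close>
      then have "w \<notin> C" using f v unfolding C_def by (metis DiffD2 imageE singletonD)
      then show "w \<in> S - C" using v w by (auto simp: A_def)
    qed
  qed
  \<comment> \<open>The accompanying inequalities rule out truncated subtraction.\<close>
  moreover have "card (S - C) = card S - card C" "card C \<le> card S"
    using CS finS by (simp_all add: card_Diff_subset finite_subset card_mono)
  moreover have "card (D - A) = card D - card A" "card A \<le> card D"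
    using finD by (simp_all add: A_def card_Diff_subset card_mono)
  moreover have "card D = card (pverts G) - card S"
    using S finS by (simp add: D_def card_Diff_subset)
  ultimately show ?thesis using cardC by linarith
qed

text \<open>A maximum or minimum over finitely many moves is attained, so whoever moves, the value
  is passed on unchanged from some successor position. Following such positions ends at a set
  \<open>T\<close> with no legal move.\<close>

lemma game_value_eq_card_maximal:
  assumes "finite (pverts G)" "S \<subseteq> pverts G" "enclaveless G S"
  shows "\<exists>T \<subseteq> pverts G. enclaveless G T \<and> legal_moves G T = {} \<and> game_value G p S = card T"
  using assms
proof (induction G p S rule: game_value.induct)
  case (1 G p S)
  show ?case
  proof (cases "legal_moves G S = {}")
    case True
    then show ?thesis using "1.prems" by (auto simp: game_value.simps[of G p S])
  next
    case False
    define V where "V = (\<lambda>v. game_value G (opponent p) (insert v S)) ` legal_moves G S"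
    have "finite V" "V \<noteq> {}"
      using False "1.prems"(1) by (auto simp: V_def legal_moves_def)
    then have "Max V \<in> V" "Min V \<in> V" by simp_all
    moreover have "game_value G p S = (case p of Maximizer \<Rightarrow> Max V | Minimizer \<Rightarrow> Min V)"
      using False "1.prems"(1) unfolding V_def by (subst game_value.simps) simp
    ultimately have "game_value G p S \<in> V" by (cases p) auto
    then obtain v where v: "v \<in> legal_moves G S"
      and eq: "game_value G p S = game_value G (opponent p) (insert v S)"
      by (auto simp: V_def)
    have "insert v S \<subseteq> pverts G" "enclaveless G (insert v S)"
      using v "1.prems"(2) by (auto simp: legal_moves_def)
    with "1.IH" False "1.prems"(1) v eq show ?thesis by (cases p) auto
  qed
qed

theorem theorem4p1:
  fixes G :: "'a pair_pre_digraph" and k n :: nat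
  assumes "k \<ge> 1"
    and "pair_graph G"
    and "regular_graph k G"
    and "card (pverts G) = n"
  shows "real (Psi_g_plus G) \<ge> 1 / 2 * real n \<and> real (Psi_g_minus G) \<ge> 1 / 2 * real n"
proof -
  interpret pair_graph G by fact
  have "enclaveless G {}" by (simp add: enclaveless_def enclave_def)
  then have "n \<le> 2 * game_value G p {}" for p
    using game_value_eq_card_maximal[of G "{}" p] card_maximal_enclaveless[OF assms(2,3,1)] assms(4)
    by auto
  from this[of Maximizer] this[of Minimizer] show ?thesis
    by (simp add: Psi_g_plus_def Psi_g_minus_def)
qed

end
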